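(* Let $X_1,X_2,L\in[1,\infty)$ with $L\ge\max(X_1,X_2)$, and let $\delta\in(0,1]$. Let $A_i\subset[X_i,2X_i]$ ($i=1,2$) be sets of integers such that $\operatorname{lcm}(a_1,a_2)\le L$ for at least $\delta|A_1||A_2|$ pairs $(a_1,a_2)\in A_1\times A_2$. Then for any $\varepsilon\in(0,1)$, $$|A_1||A_2|\ll_{\varepsilon}\delta^{-2-\varepsilon}\,\frac{L^2}{X_1X_2},$$ where the implied constant depends only on $\varepsilon$. *)

theory Defs
  imports Complex_Main
begin

end

theory Submission
  imports Defs "HOL-Analysis.Summation_Tests" "HOL-Computational_Algebra.Primes"
begin

text \<open>
  Since $\mathrm{lcm}(a,b) \le L$ forces $\gcd(a,b) \ge D := X_1 X_2 / L$, the claim is the bound of Green and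
  Walker for bipartite graphs $E \subseteq A \times B$ all of whose edges have a large gcd. With $Q = 2 + \varepsilon$
  and density $\delta$, the quality $\delta^Q |A| |B| D^2 / (X Y)$ is compared with that of the layers obtained by
  prescribing the exact exponents $i$, $j$ of a prime $p$ in $a$ and $b$ and dividing them out, which costs
  nothing in the target bound up to the factor $p^{|i-j|}$.

  For a large prime either some layer has larger quality, so that $p$ can be removed, or all edge fractions
  satisfy $e_{ij} \le (\alpha_i \beta_j)^{1-1/Q} p^{-|i-j|/Q}$. In the latter case almost everything lies at a
  single exponent $k_p$, and because $1/Q < 1/2$ the edges avoiding $k_p$ at both ends form a fraction
  $O(p^{-(2-2/Q)})$ of all edges, which is summable over $p$, independently of $\delta$. The finitely many small
  primes are removed at the cost of a constant each.

  Once no prime can be removed, put $N = \prod_p p^{k_p}$. For at least half of the edges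
  $\gcd(a,b) \cdot \frac{N}{\gcd(a,N)} \cdot \frac{N}{\gcd(b,N)}$ divides $N$, and counting the multiples of $\gcd(a,N)$ and
  $\gcd(b,N)$ finishes the proof without any logarithmic loss.
\<close>

section \<open>The inequality at a single prime\<close>

text \<open>On naturals at least one of the two truncated differences is 0, so this is the distance
  |i - j|.\<close>

abbreviation offset :: "nat \<Rightarrow> nat \<Rightarrow> nat" where
  "offset i j \<equiv> (i - j) + (j - i)"

text \<open>The exponents are distinct and at least 1, so the sum is a subsum of q + q^2 + q^3 +
  ...\<close>

lemma sum_power_inj_le:
  fixes q :: real
  assumes "finite J" "inj_on h J" "0 \<le> q" "q < 1" "\<And>j. j \<in> J \<Longrightarrow> h j \<ge> 1"
  shows "(\<Sum>j\<in>J. q ^ h j) \<le> q / (1 - q)"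
proof -
  have inj: "inj_on (\<lambda>j. h j - 1) J"
    using assms(2,5) by (auto simp: inj_on_def) (metis Suc_pred' le_simps(3) One_nat_def)
  have "(\<Sum>j\<in>J. q ^ h j) = (\<Sum>j\<in>J. q * q ^ (h j - 1))"
    using assms(5) by (intro sum.cong refl) (metis Suc_pred' le_simps(3) One_nat_def power_Suc)
  also have "\<dots> = (\<Sum>m\<in>(\<lambda>j. h j - 1) ` J. q * q ^ m)"
    using inj by (simp add: sum.reindex)
  also have "\<dots> \<le> (\<Sum>m. q * q ^ m)"
    using assms by (intro sum_le_suminf summable_mult summable_geometric) auto
  also have "\<dots> = q / (1 - q)"
    using assms by (simp add: suminf_mult summable_geometric suminf_geometric)
  finally show ?thesis .
qed

text \<open>Every positive distance from i occurs at most twice, once on each side, which gives two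
  geometric series.\<close>

lemma sum_offset_power_le:
  fixes q :: real
  assumes "finite I" "0 \<le> q" "q < 1"
  shows "(\<Sum>j\<in>I - {i}. q ^ offset i j) \<le> 2 * q / (1 - q)"
proof -
  have "(\<Sum>j\<in>I - {i}. q ^ offset i j) = (\<Sum>j\<in>{j \<in> I. j < i} \<union> {j \<in> I. i < j}. q ^ offset i j)"
    by (intro sum.cong) auto
  also have "\<dots> = (\<Sum>j\<in>{j \<in> I. j < i}. q ^ offset i j) + (\<Sum>j\<in>{j \<in> I. i < j}. q ^ offset i j)"
    using assms(1) by (intro sum.union_disjoint) auto
  also have "\<dots> \<le> q / (1 - q) + q / (1 - q)"
    using assms by (intro add_mono sum_power_inj_le) (auto simp: inj_on_def)
  finally show ?thesis by simp
qed

text \<open>On [0,1] a larger exponent gives a smaller power, so s may be lowered to 1/2, where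
  AM-GM applies. Later s = 1 - 1/Q, so s > 1/2 is the condition Q > 2.\<close>

lemma powr_mult_le_mean:
  fixes x y s :: real
  assumes "0 \<le> x" "x \<le> 1" "0 \<le> y" "y \<le> 1" "1/2 \<le> s"
  shows "(x * y) powr s \<le> (x + y) / 2"
proof -
  have "(x * y) powr s \<le> (x * y) powr (1/2)"
    using assms by (intro powr_mono') (auto simp: mult_le_one)
  also have "\<dots> = sqrt (x * y)"
    using assms by (simp add: powr_half_sqrt)
  also have "\<dots> \<le> (x + y) / 2"
    using assms by (intro arith_geo_mean_sqrt) auto
  finally show ?thesis .
qed

text \<open>A Schur test. After normalising u and v to total mass 1,
  \<open>powr_mult_le_mean\<close> replaces each power by an arithmetic mean. This separates the u
  part, which sees only row sums of the kernel, from the v part, which sees only column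
  sums.\<close>

lemma sum_weighted_powr_le:
  fixes u v :: "nat \<Rightarrow> real"
  assumes fin: "finite I" and u: "\<And>i. i \<in> I \<Longrightarrow> 0 \<le> u i" and v: "\<And>i. i \<in> I \<Longrightarrow> 0 \<le> v i"
    and s: "1/2 \<le> s" and c: "\<And>i j. 0 \<le> c i j"
    and row: "\<And>i. i \<in> I \<Longrightarrow> (\<Sum>j\<in>I. c i j) \<le> K"
    and col: "\<And>j. j \<in> I \<Longrightarrow> (\<Sum>i\<in>I. c i j) \<le> K"
  shows "(\<Sum>i\<in>I. \<Sum>j\<in>I. (u i * v j) powr s * c i j) \<le> (sum u I * sum v I) powr s * K"
proof (cases "sum u I = 0 \<or> sum v I = 0")
  case True
  hence "(\<forall>i\<in>I. u i = 0) \<or> (\<forall>i\<in>I. v i = 0)"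
    using fin u v by (auto simp: sum_nonneg_eq_0_iff)
  hence "(\<Sum>i\<in>I. \<Sum>j\<in>I. (u i * v j) powr s * c i j) = 0"
    by (auto intro!: sum.neutral)
  thus ?thesis using True by auto
next
  case False
  define U V where "U = sum u I" and "V = sum v I"
  have UV: "U > 0" "V > 0"
    using False u v by (auto simp: U_def V_def less_le intro!: sum_nonneg)
  have le1: "u i / U \<le> 1" "v i / V \<le> 1" if "i \<in> I" for i
    using that UV fin u v by (auto simp: U_def V_def divide_le_eq intro!: member_le_sum)
  have one: "(\<Sum>i\<in>I. u i / U) = 1" "(\<Sum>i\<in>I. v i / V) = 1"
    using UV by (auto simp: U_def V_def sum_divide_distrib[symmetric])
  have "(\<Sum>i\<in>I. \<Sum>j\<in>I. (u i * v j) powr s * c i j)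
     \<le> (\<Sum>i\<in>I. \<Sum>j\<in>I. (U * V) powr s * (((u i / U) + (v j / V)) / 2 * c i j))"
  proof (intro sum_mono)
    fix i j assume ij: "i \<in> I" "j \<in> I"
    have "(u i * v j) powr s = (U * V) powr s * ((u i / U) * (v j / V)) powr s"
      using UV u v ij by (subst powr_mult[symmetric]) (auto simp: field_simps)
    also have "\<dots> \<le> (U * V) powr s * (((u i / U) + (v j / V)) / 2)"
      using UV u v ij le1 s by (intro mult_left_mono powr_mult_le_mean) auto
    finally show "(u i * v j) powr s * c i j \<le> (U * V) powr s * (((u i / U) + (v j / V)) / 2 * c i j)"
      using c[of i j] mult_right_mono by fastforce
  qed
  also have "\<dots> = (U * V) powr s * (((\<Sum>i\<in>I. u i / U * (\<Sum>j\<in>I. c i j)) + (\<Sum>i\<in>I. \<Sum>j\<in>I. v j / V * c i j)) / 2)"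
    by (simp add: sum_distrib_left sum.distrib sum_divide_distrib algebra_simps add_divide_distrib)
  also have "(\<Sum>i\<in>I. \<Sum>j\<in>I. v j / V * c i j) = (\<Sum>j\<in>I. v j / V * (\<Sum>i\<in>I. c i j))"
    by (subst sum.swap) (simp add: sum_distrib_left)
  also have "(U * V) powr s * (((\<Sum>i\<in>I. u i / U * (\<Sum>j\<in>I. c i j)) + (\<Sum>j\<in>I. v j / V * (\<Sum>i\<in>I. c i j))) / 2)
    \<le> (U * V) powr s * (((\<Sum>i\<in>I. u i / U * K) + (\<Sum>j\<in>I. v j / V * K)) / 2)"
    using UV u v row col
    by (intro mult_left_mono divide_right_mono add_mono sum_mono) auto
  also have "\<dots> = (U * V) powr s * K"
    using one by (simp only: sum_distrib_right[symmetric]) simp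
  finally show ?thesis by (simp add: U_def V_def)
qed

lemma sum_offset_kernel_le:
  fixes u v :: "nat \<Rightarrow> real"
  assumes "finite I" "\<And>i. i \<in> I \<Longrightarrow> 0 \<le> u i" "\<And>i. i \<in> I \<Longrightarrow> 0 \<le> v i"
    and "1/2 \<le> s" and q: "0 \<le> q" "q < 1"
  shows "(\<Sum>i\<in>I. \<Sum>j\<in>I. (u i * v j) powr s * q ^ offset i j)
      \<le> (sum u I * sum v I) powr s * (1 + 2 * q / (1 - q))"
proof -
  have row: "(\<Sum>j\<in>I. q ^ offset i j) \<le> 1 + 2 * q / (1 - q)" if "i \<in> I" for i
    using sum_offset_power_le[of I q i] assms that by (subst sum.remove[of _ i]) auto
  show ?thesis
    using assms row by (intro sum_weighted_powr_le) (auto simp: add.commute)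
qed

text \<open>Without the diagonal the kernel has norm O(q). For small q nearly all edge mass must
  therefore come from the diagonal i = j.\<close>

lemma sum_offset_kernel_offdiag_le:
  fixes u v :: "nat \<Rightarrow> real"
  assumes "finite I" "\<And>i. i \<in> I \<Longrightarrow> 0 \<le> u i" "\<And>i. i \<in> I \<Longrightarrow> 0 \<le> v i"
    and "1/2 \<le> s" and q: "0 \<le> q" "q < 1"
  shows "(\<Sum>i\<in>I. \<Sum>j\<in>I. (u i * v j) powr s * (if i = j then 0 else q ^ offset i j))
      \<le> (sum u I * sum v I) powr s * (2 * q / (1 - q))"
proof -
  have row: "(\<Sum>j\<in>I. if i = j then 0 else q ^ offset i j) \<le> 2 * q / (1 - q)" if "i \<in> I" for i
  proof -
    have "(\<Sum>j\<in>I. if i = j then 0 else q ^ offset i j) = (\<Sum>j\<in>I - {i}. q ^ offset i j)"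
      using assms(1) that by (subst sum.remove[of _ i]) (auto intro!: sum.cong)
    thus ?thesis using sum_offset_power_le[of I q i] assms by simp
  qed
  have "(\<Sum>j\<in>I. if j = i then 0 else q ^ offset j i) \<le> 2 * q / (1 - q)" if "i \<in> I" for i
  proof -
    have "(\<Sum>j\<in>I. if j = i then 0 else q ^ offset j i) = (\<Sum>j\<in>I. if i = j then 0 else q ^ offset i j)"
      by (intro sum.cong refl) (simp add: add.commute)
    thus ?thesis using row[OF that] by simp
  qed
  thus ?thesis
    using assms row by (intro sum_weighted_powr_le) auto
qed

text \<open>The right side is the tangent line of the square root at t = 1; this is the case y = 1
  of \<open>powr_mult_le_mean\<close>.\<close>

lemma powr_le_tangent:
  fixes t s :: real
  assumes "0 \<le> t" "t \<le> 1" "1/2 \<le> s"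
  shows "t powr s \<le> 1 - (1 - t) / 2"
proof -
  have "(t * 1) powr s \<le> (t + 1) / 2"
    using assms by (intro powr_mult_le_mean) auto
  thus ?thesis by (simp add: field_simps)
qed

text \<open>Here x and y stand for the masses away from the central exponent. With t = max x y, the
  first term of \<open>main\<close> falls short of 1 by at least t/4, and the others must make up
  for it: t/4 is at most 8 q t^s + 3 t^(2s). Because 2s > 1 and t is small, the last term is
  absorbed. What remains is t^(1-s) at most 64 q, a power saving in q in place of mere
  smallness.\<close>

lemma bootstrap_tail_bound:
  fixes x y q s :: real
  assumes s: "1/2 < s" "s < 1" and q: "0 < q"
    and x: "0 \<le> x" "x \<le> (1/24) powr (1 / (2 * s - 1))"
    and y: "0 \<le> y" "y \<le> (1/24) powr (1 / (2 * s - 1))"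
    and main: "1 \<le> ((1 - x) * (1 - y)) powr s + 4 * q * (x powr s + y powr s) + 3 * (x * y) powr s"
  shows "(x * y) powr s \<le> (64 * q) powr (2 * s / (1 - s))"
proof -
  define t where "t = max x y"
  have t: "0 \<le> t" "t \<le> (1/24) powr (1 / (2 * s - 1))" "x \<le> t" "y \<le> t"
    using x y by (auto simp: t_def)
  have k1: "(1/24::real) powr (1 / (2 * s - 1)) \<le> 1"
    using s by (intro powr_le1) auto
  have x1: "x \<le> 1" "y \<le> 1" "t \<le> 1" using t x y k1 by linarith+
  define r where "r = (1 - x) * (1 - y)"
  have "r powr s \<le> 1 - (1 - r) / 2"
    unfolding r_def using x y x1 s by (intro powr_le_tangent) (auto simp: mult_le_one)
  moreover have "1 - r \<ge> t / 2"
  proof -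
    have "x * y \<le> x" "x * y \<le> y" using x y x1 by (auto simp: mult_left_le mult_left_le_one_le)
    hence "1 - r \<ge> t" by (auto simp: r_def t_def max_def algebra_simps)
    thus ?thesis using t(1) by linarith
  qed
  ultimately have "r powr s \<le> 1 - t / 4" by (simp add: field_simps)
  moreover have "x powr s \<le> t powr s" "y powr s \<le> t powr s"
    using t x y s by (auto intro!: powr_mono2)
  hence "4 * q * (x powr s + y powr s) \<le> 4 * q * (t powr s + t powr s)"
    using q by (intro mult_left_mono) auto
  moreover have xy: "(x * y) powr s \<le> t powr (2 * s)"
  proof -
    have "(x * y) powr s \<le> (t * t) powr s"
      using t x y s by (intro powr_mono2 mult_mono) auto
    also have "\<dots> = t powr (2 * s)"
      using t(1) by (simp add: powr_mult powr_add[symmetric])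
    finally show ?thesis .
  qed
  ultimately have key: "t / 4 \<le> 8 * q * t powr s + 3 * t powr (2 * s)"
    using main unfolding r_def[symmetric] by (simp add: algebra_simps)
  have "t powr (1 - s) \<le> 64 * q"
  proof (cases "t = 0")
    case True thus ?thesis using q s by simp
  next
    case False
    hence tp: "t > 0" using t by simp
    \<comment> \<open>The threshold 1/24 makes 3 t^(2s) at most t/8, which is half of the t/4 on the
      left of \<open>key\<close>.\<close>
    have "t powr (2 * s - 1) \<le> ((1/24) powr (1 / (2 * s - 1))) powr (2 * s - 1)"
      using t s by (intro powr_mono2) auto
    also have "\<dots> = 1/24" using s by (simp add: powr_powr)
    finally have a: "t powr (2 * s - 1) \<le> 1/24" .
    have "t powr (2 * s) = t * t powr (2 * s - 1)"
      using tp by (simp add: powr_diff)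
    also have "\<dots> \<le> t * (1/24)" using a tp by (intro mult_left_mono) auto
    finally have "t / 8 \<le> 8 * q * t powr s" using key by linarith
    hence "t \<le> t powr s * (64 * q)" by (simp add: mult_ac)
    moreover have "t powr s * t powr (1 - s) = t" using tp by (simp add: powr_add[symmetric])
    ultimately have "t powr s * (t powr (1 - s)) \<le> t powr s * (64 * q)" by metis
    thus ?thesis using tp by (metis mult_le_cancel_left_pos powr_gt_zero less_irrefl)
  qed
  hence "(t powr (1 - s)) powr (2 * s / (1 - s)) \<le> (64 * q) powr (2 * s / (1 - s))"
    using s by (intro powr_mono2) auto
  also have "(t powr (1 - s)) powr (2 * s / (1 - s)) = t powr (2 * s)"
    using s by (simp add: powr_powr)
  finally show ?thesis using xy by linarith
qed


text \<open>Take k maximising the product of the two weights, with maximum m. Splitting off the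
  power s - 1/2 and applying AM-GM to the remaining square root bounds the diagonal sum by
  m^(s-1/2), as the means sum to 1. Hence c is at most m, and each weight at k is at least m since
  the other is at most 1.\<close>

lemma diagonal_concentration:
  fixes \<alpha> \<beta> :: "nat \<Rightarrow> real"
  assumes fin: "finite I" and s: "1/2 < s"
    and a: "\<And>i. i \<in> I \<Longrightarrow> 0 \<le> \<alpha> i" "sum \<alpha> I = 1"
    and b: "\<And>i. i \<in> I \<Longrightarrow> 0 \<le> \<beta> i" "sum \<beta> I = 1"
    and low: "c powr (s - 1/2) \<le> (\<Sum>i\<in>I. (\<alpha> i * \<beta> i) powr s)" and c: "0 < c"
  shows "\<exists>k\<in>I. c \<le> \<alpha> k \<and> c \<le> \<beta> k"
proof -
  have I: "I \<noteq> {}" using a(2) by auto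
  define m where "m = Max ((\<lambda>i. \<alpha> i * \<beta> i) ` I)"
  have "m \<in> (\<lambda>i. \<alpha> i * \<beta> i) ` I" unfolding m_def using fin I by (intro Max_in) auto
  then obtain k where k: "k \<in> I" "m = \<alpha> k * \<beta> k" by auto
  have mle: "\<alpha> i * \<beta> i \<le> m" if "i \<in> I" for i
    unfolding m_def using fin that by (intro Max_ge) auto
  have m0: "0 \<le> m" using k a b by simp
  have le1: "\<alpha> i \<le> 1" "\<beta> i \<le> 1" if "i \<in> I" for i
    using member_le_sum[of i I \<alpha>] member_le_sum[of i I \<beta>] that fin a b by auto
  have "(\<Sum>i\<in>I. (\<alpha> i * \<beta> i) powr s) \<le> (\<Sum>i\<in>I. m powr (s - 1/2) * ((\<alpha> i + \<beta> i) / 2))"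
  proof (rule sum_mono)
    fix i assume i: "i \<in> I"
    have "(\<alpha> i * \<beta> i) powr s = (\<alpha> i * \<beta> i) powr (s - 1/2) * (\<alpha> i * \<beta> i) powr (1/2)"
      by (simp add: powr_add[symmetric])
    also have "\<dots> \<le> m powr (s - 1/2) * ((\<alpha> i + \<beta> i) / 2)"
      using i a b mle m0 le1 s by (intro mult_mono powr_mono2 powr_mult_le_mean) auto
    finally show "(\<alpha> i * \<beta> i) powr s \<le> m powr (s - 1/2) * ((\<alpha> i + \<beta> i) / 2)" .
  qed
  also have "\<dots> = m powr (s - 1/2)"
    using a b by (simp add: sum_distrib_left[symmetric] sum_divide_distrib[symmetric] sum.distrib)
  finally have "c powr (s - 1/2) \<le> m powr (s - 1/2)" using low by linarith
  hence "c \<le> m"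
    using powr_less_mono2[of "s - 1/2" m c] s m0 by fastforce
  moreover have "m \<le> \<alpha> k" "m \<le> \<beta> k"
    using k a b le1[of k] by (auto simp: mult_left_le mult_left_le_one_le)
  ultimately show ?thesis using k by (intro bexI[of _ k]) auto
qed

text \<open>The argument has two rounds. First the O(q) bound off the diagonal forces some exponent
  k to carry almost all of both weights, with a loss bounded only by a constant. Then the total mass
  1 is split into the cell (k,k), the rest of its row, the rest of its column, and the remaining
  block; \<open>bootstrap_tail_bound\<close> turns this into a power of q.\<close>

lemma local_concentration:
  fixes s :: real
  assumes s: "1/2 < s" "s < 1"
  obtains q0 :: real where "0 < q0"
    "\<And>(I :: nat set) \<alpha> \<beta> e q. finite I \<Longrightarrow> (\<And>i. i \<in> I \<Longrightarrow> 0 \<le> \<alpha> i) \<Longrightarrow> sum \<alpha> I = 1 \<Longrightarrow>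
      (\<And>i. i \<in> I \<Longrightarrow> 0 \<le> \<beta> i) \<Longrightarrow> sum \<beta> I = 1 \<Longrightarrow> 0 < q \<Longrightarrow> q \<le> q0 \<Longrightarrow>
      (\<Sum>i\<in>I. \<Sum>j\<in>I. e i j) = 1 \<Longrightarrow>
      (\<And>i j. i \<in> I \<Longrightarrow> j \<in> I \<Longrightarrow> e i j \<le> (\<alpha> i * \<beta> j) powr s * q ^ offset i j) \<Longrightarrow>
      \<exists>k\<in>I. (\<Sum>i\<in>I - {k}. \<Sum>j\<in>I - {k}. e i j) \<le> 3 * (64 * q) powr (2 * s / (1 - s))"
proof -
  define \<kappa> :: real where "\<kappa> = (1/24) powr (1 / (2 * s - 1))"
  have \<kappa>: "0 < \<kappa>" "\<kappa> < 1"
    using s powr_less_mono2[of "1 / (2 * s - 1)" "1/24" 1] by (auto simp: \<kappa>_def)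
  \<comment> \<open>For q up to this value, 1 - 4q is still at least the diagonal mass that
    \<open>diagonal_concentration\<close> requires for c = 1 - \<kappa>.\<close>
  define q0 where "q0 = (1 - (1 - \<kappa>) powr (s - 1/2)) / 4"
  have "(1 - \<kappa>) powr (s - 1/2) < 1 powr (s - 1/2)"
    using \<kappa> s by (intro powr_less_mono2) auto
  hence q0: "0 < q0" "q0 \<le> 1/4" by (auto simp: q0_def)
  show ?thesis
  proof (rule that[of q0])
    show "0 < q0" using q0 by auto
  next
    fix I :: "nat set" and \<alpha> \<beta> :: "nat \<Rightarrow> real" and e q
    assume fin: "finite I" and a: "\<And>i. i \<in> I \<Longrightarrow> 0 \<le> \<alpha> i" "sum \<alpha> I = 1"
      and b: "\<And>i. i \<in> I \<Longrightarrow> 0 \<le> \<beta> i" "sum \<beta> I = 1" and q: "0 < q" "q \<le> q0"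
      and e1: "(\<Sum>i\<in>I. \<Sum>j\<in>I. e i j) = 1"
      and e: "\<And>i j. i \<in> I \<Longrightarrow> j \<in> I \<Longrightarrow> e i j \<le> (\<alpha> i * \<beta> j) powr s * q ^ offset i j"
    have q4: "q \<le> 1/4" using q q0 by linarith
    have geom: "2 * q / (1 - q) \<le> 4 * q" "1 + 2 * q / (1 - q) \<le> 3"
      using q q4 by (auto simp: field_simps)
    have "1 \<le> (\<Sum>i\<in>I. \<Sum>j\<in>I. (\<alpha> i * \<beta> j) powr s * q ^ offset i j)"
      unfolding e1[symmetric] by (intro sum_mono e)
    also have "\<dots> = (\<Sum>i\<in>I. (\<alpha> i * \<beta> i) powr s)
        + (\<Sum>i\<in>I. \<Sum>j\<in>I. (\<alpha> i * \<beta> j) powr s * (if i = j then 0 else q ^ offset i j))"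
      unfolding sum.distrib[symmetric]
    proof (intro sum.cong refl)
      fix i assume i: "i \<in> I"
      have "(\<Sum>j\<in>I. (\<alpha> i * \<beta> j) powr s * (if i = j then 0 else q ^ offset i j))
          = (\<Sum>j\<in>I - {i}. (\<alpha> i * \<beta> j) powr s * q ^ offset i j)"
        using fin i by (subst sum.remove[of _ i]) (auto intro!: sum.cong)
      thus "(\<Sum>j\<in>I. (\<alpha> i * \<beta> j) powr s * q ^ offset i j) = (\<alpha> i * \<beta> i) powr s +
          (\<Sum>j\<in>I. (\<alpha> i * \<beta> j) powr s * (if i = j then 0 else q ^ offset i j))"
        using fin i by (subst sum.remove[of _ i]) auto
    qed
    also have "(\<Sum>i\<in>I. \<Sum>j\<in>I. (\<alpha> i * \<beta> j) powr s * (if i = j then 0 else q ^ offset i j)) \<le> 4 * q"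
      using sum_offset_kernel_offdiag_le[of I \<alpha> \<beta> s q] fin a b s q q4 geom by simp
    finally have "1 - 4 * q \<le> (\<Sum>i\<in>I. (\<alpha> i * \<beta> i) powr s)" by simp
    moreover have "(1 - \<kappa>) powr (s - 1/2) \<le> 1 - 4 * q" using q by (simp add: q0_def)
    ultimately have "\<exists>k\<in>I. 1 - \<kappa> \<le> \<alpha> k \<and> 1 - \<kappa> \<le> \<beta> k"
      using fin a b s \<kappa> by (intro diagonal_concentration) auto
    then obtain k where k: "k \<in> I" "1 - \<kappa> \<le> \<alpha> k" "1 - \<kappa> \<le> \<beta> k" by blast
    define x y where "x = sum \<alpha> (I - {k})" and "y = sum \<beta> (I - {k})"
    have ak: "\<alpha> k = 1 - x" "\<beta> k = 1 - y"
      using a b fin k(1) by (auto simp: x_def y_def sum_diff1)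
    have x: "0 \<le> x" "x \<le> \<kappa>" and y: "0 \<le> y" "y \<le> \<kappa>"
      using a b k ak by (auto simp: x_def y_def intro!: sum_nonneg)
    have xi: "\<alpha> i \<le> x" "\<beta> i \<le> y" if "i \<in> I - {k}" for i
      using that fin a b by (auto simp: x_def y_def intro!: member_le_sum)
    define bad where "bad = (\<Sum>i\<in>I - {k}. \<Sum>j\<in>I - {k}. e i j)"
    have "bad \<le> (\<Sum>i\<in>I - {k}. \<Sum>j\<in>I - {k}. (\<alpha> i * \<beta> j) powr s * q ^ offset i j)"
      unfolding bad_def by (intro sum_mono e) auto
    also have "\<dots> \<le> (x * y) powr s * (1 + 2 * q / (1 - q))"
      unfolding x_def y_def using fin a b s q q4 by (intro sum_offset_kernel_le) auto
    also have "\<dots> \<le> (x * y) powr s * 3" using geom by (intro mult_left_mono) auto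
    finally have bad: "bad \<le> 3 * (x * y) powr s" by simp
    have row: "(\<Sum>j\<in>I - {k}. e k j) \<le> 4 * q * y powr s"
    proof -
      have "(\<Sum>j\<in>I - {k}. e k j) \<le> (\<Sum>j\<in>I - {k}. y powr s * q ^ offset k j)"
      proof (rule sum_mono)
        fix j assume j: "j \<in> I - {k}"
        have "e k j \<le> (\<alpha> k * \<beta> j) powr s * q ^ offset k j" using e k j by auto
        also have "\<dots> \<le> y powr s * q ^ offset k j"
        \<comment> \<open>In the row of k only the trivial bound 1 is used for the weight of k, and
          y for the other weight; the factor q comes from the distance to k.\<close>
        proof -
          have "\<alpha> k * \<beta> j \<le> 1 * y"
            using j k a b x y \<kappa>(2) ak xi[OF j] by (intro mult_mono) auto
          thus ?thesis using j k a b s q by (intro mult_right_mono powr_mono2) auto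
        qed
        finally show "e k j \<le> y powr s * q ^ offset k j" .
      qed
      also have "\<dots> \<le> y powr s * (2 * q / (1 - q))"
        unfolding sum_distrib_left[symmetric] using fin q q4
        by (intro mult_left_mono sum_offset_power_le) auto
      also have "\<dots> \<le> y powr s * (4 * q)" using geom by (intro mult_left_mono) auto
      finally show ?thesis by (simp add: mult_ac)
    qed
    have col: "(\<Sum>i\<in>I - {k}. e i k) \<le> 4 * q * x powr s"
    proof -
      have "(\<Sum>i\<in>I - {k}. e i k) \<le> (\<Sum>i\<in>I - {k}. x powr s * q ^ offset k i)"
      proof (rule sum_mono)
        fix i assume i: "i \<in> I - {k}"
        have "e i k \<le> (\<alpha> i * \<beta> k) powr s * q ^ offset i k" using e k i by auto
        also have "\<dots> \<le> x powr s * q ^ offset i k"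
        proof -
          have "\<alpha> i * \<beta> k \<le> x * 1"
            using i k a b x y \<kappa>(2) ak xi[OF i] by (intro mult_mono) auto
          thus ?thesis using i k a b s q by (intro mult_right_mono powr_mono2) auto
        qed
        finally show "e i k \<le> x powr s * q ^ offset k i" by (simp add: add.commute)
      qed
      also have "\<dots> \<le> x powr s * (2 * q / (1 - q))"
        unfolding sum_distrib_left[symmetric] using fin q q4
        by (intro mult_left_mono sum_offset_power_le) auto
      also have "\<dots> \<le> x powr s * (4 * q)" using geom by (intro mult_left_mono) auto
      finally show ?thesis by (simp add: mult_ac)
    qed
    \<comment> \<open>Decomposition of the total mass into the centre, its row, its column and the
      block \<open>bad\<close> that avoids k on both sides.\<close>
    have "1 = (\<Sum>j\<in>I. e k j) + (\<Sum>i\<in>I - {k}. \<Sum>j\<in>I. e i j)"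
      unfolding e1[symmetric] using fin k(1) by (rule sum.remove)
    also have "(\<Sum>j\<in>I. e k j) = e k k + (\<Sum>j\<in>I - {k}. e k j)"
      using fin k(1) by (rule sum.remove)
    also have "(\<Sum>i\<in>I - {k}. \<Sum>j\<in>I. e i j) = (\<Sum>i\<in>I - {k}. e i k + (\<Sum>j\<in>I - {k}. e i j))"
      using fin k(1) by (intro sum.cong refl sum.remove)
    also have "\<dots> = (\<Sum>i\<in>I - {k}. e i k) + bad"
      by (simp add: sum.distrib bad_def)
    finally have "1 = e k k + (\<Sum>j\<in>I - {k}. e k j) + ((\<Sum>i\<in>I - {k}. e i k) + bad)" .
    moreover have "e k k \<le> ((1 - x) * (1 - y)) powr s"
      using e[OF k(1) k(1)] by (simp add: ak)
    ultimately have "1 \<le> ((1 - x) * (1 - y)) powr s + 4 * q * (x powr s + y powr s)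
        + 3 * (x * y) powr s"
      using row col bad by (simp add: algebra_simps)
    hence "(x * y) powr s \<le> (64 * q) powr (2 * s / (1 - s))"
      using s q q4 x y unfolding \<kappa>_def by (intro bootstrap_tail_bound) auto
    with bad show "\<exists>k\<in>I. (\<Sum>i\<in>I - {k}. \<Sum>j\<in>I - {k}. e i j) \<le> 3 * (64 * q) powr (2 * s / (1 - s))"
      using k(1) unfolding bad_def by (intro bexI[of _ k]) auto
  qed
qed

section \<open>Graphs with large greatest common divisors\<close>

text \<open>Only upper bounds X and Y are recorded, not dyadic ranges. They suffice for counting
  multiples, and the class is then closed under dividing out prime powers.\<close>

definition gcd_system :: "nat set \<Rightarrow> nat set \<Rightarrow> (nat \<times> nat) set \<Rightarrow> real \<Rightarrow> real \<Rightarrow> real \<Rightarrow> bool" where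
  "gcd_system A B E X Y D \<longleftrightarrow> finite A \<and> finite B \<and> E \<subseteq> A \<times> B \<and> 0 < X \<and> 0 < Y \<and> 0 < D \<and>
     (\<forall>a\<in>A. 0 < a \<and> real a \<le> X) \<and> (\<forall>b\<in>B. 0 < b \<and> real b \<le> Y) \<and>
     (\<forall>(a, b)\<in>E. D \<le> real (gcd a b))"

text \<open>With edge density d = |E| / (|A||B|) this is d^Q |A||B| D^2 / (XY) for nonempty A and B.
  A uniform bound on it is the target estimate, solved for |A||B|.\<close>

definition quality ::
  "real \<Rightarrow> nat set \<Rightarrow> nat set \<Rightarrow> (nat \<times> nat) set \<Rightarrow> real \<Rightarrow> real \<Rightarrow> real \<Rightarrow> real" where
  "quality Q A B E X Y D =
     real (card E) powr Q * real (card A * card B) powr (1 - Q) * (D\<^sup>2 / (X * Y))"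

text \<open>Encoded as a preimage under multiplication by p^i, so its members are the cofactors
  prime to p and no division occurs.\<close>

definition layer :: "nat \<Rightarrow> nat \<Rightarrow> nat set \<Rightarrow> nat set" where
  "layer p i A = {a. \<not> p dvd a \<and> p ^ i * a \<in> A}"

definition edge_layer :: "nat \<Rightarrow> nat \<Rightarrow> nat \<Rightarrow> (nat \<times> nat) set \<Rightarrow> (nat \<times> nat) set" where
  "edge_layer p i j E = {(a, b). \<not> p dvd a \<and> \<not> p dvd b \<and> (p ^ i * a, p ^ j * b) \<in> E}"

definition quality_layer ::
  "real \<Rightarrow> nat \<Rightarrow> nat \<Rightarrow> nat \<Rightarrow> nat set \<Rightarrow> nat set \<Rightarrow> (nat \<times> nat) set \<Rightarrow> real \<Rightarrow> real \<Rightarrow> real \<Rightarrow> real" where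
  "quality_layer Q p i j A B E X Y D = quality Q (layer p i A) (layer p j B) (edge_layer p i j E)
     (X / real p ^ i) (Y / real p ^ j) (D / real p ^ min i j)"

lemma gcd_systemD:
  assumes "gcd_system A B E X Y D"
  shows "finite A" "finite B" "finite E" "E \<subseteq> A \<times> B" "0 < X" "0 < Y" "0 < D"
    "\<And>a. a \<in> A \<Longrightarrow> 0 < a" "\<And>a. a \<in> A \<Longrightarrow> real a \<le> X"
    "\<And>b. b \<in> B \<Longrightarrow> 0 < b" "\<And>b. b \<in> B \<Longrightarrow> real b \<le> Y"
    "\<And>a b. (a, b) \<in> E \<Longrightarrow> D \<le> real (gcd a b)"
  using assms by (auto simp: gcd_system_def intro: finite_subset)

text \<open>Multiplication by p^i identifies a layer with a fibre of \<open>multiplicity p\<close>.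
  The number 0 is excluded because its multiplicity is 0 by convention although p divides
  it.\<close>

lemma layer_image:
  assumes "prime p" "0 \<notin> A"
  shows "(\<lambda>a. p ^ i * a) ` layer p i A = {a \<in> A. multiplicity p a = i}"
proof (intro equalityI subsetI)
  fix x assume "x \<in> (\<lambda>a. p ^ i * a) ` layer p i A"
  then obtain a where "\<not> p dvd a" "p ^ i * a \<in> A" "x = p ^ i * a"
    by (auto simp: layer_def)
  thus "x \<in> {a \<in> A. multiplicity p a = i}"
    using assms by (auto intro!: multiplicity_decomposeI dest: prime_gt_0_nat)
next
  fix x assume x: "x \<in> {a \<in> A. multiplicity p a = i}"
  hence "x \<noteq> 0" "\<not> is_unit p" using assms by (auto intro!: Nat.gr0I)
  then obtain y where "x = p ^ multiplicity p x * y" "\<not> p dvd y"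
    by (rule multiplicity_decompose')
  thus "x \<in> (\<lambda>a. p ^ i * a) ` layer p i A"
    using x by (intro image_eqI[of _ _ y]) (auto simp: layer_def)
qed

lemma card_layer:
  assumes "prime p" "0 \<notin> A"
  shows "card (layer p i A) = card {a \<in> A. multiplicity p a = i}"
  unfolding layer_image[OF assms, symmetric] using assms(1)
  by (intro card_image[symmetric]) (auto simp: inj_on_def)

lemma edge_layer_image:
  assumes "prime p" "0 \<notin> A" "0 \<notin> B" "E \<subseteq> A \<times> B"
  shows "map_prod ((*) (p ^ i)) ((*) (p ^ j)) ` edge_layer p i j E
    = {e \<in> E. multiplicity p (fst e) = i \<and> multiplicity p (snd e) = j}"
proof (intro equalityI subsetI)
  fix x assume "x \<in> map_prod ((*) (p ^ i)) ((*) (p ^ j)) ` edge_layer p i j E"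
  then obtain a b where "\<not> p dvd a" "\<not> p dvd b" "(p ^ i * a, p ^ j * b) \<in> E"
    "x = (p ^ i * a, p ^ j * b)"
    by (auto simp: edge_layer_def)
  thus "x \<in> {e \<in> E. multiplicity p (fst e) = i \<and> multiplicity p (snd e) = j}"
    using assms by (auto intro!: multiplicity_decomposeI dest: prime_gt_0_nat)
next
  fix x assume "x \<in> {e \<in> E. multiplicity p (fst e) = i \<and> multiplicity p (snd e) = j}"
  then obtain a b where x: "x = (a, b)" "(a, b) \<in> E" "multiplicity p a = i" "multiplicity p b = j"
    by (cases x) auto
  hence ne: "a \<noteq> 0" "b \<noteq> 0" "\<not> is_unit p" using assms by (auto intro!: Nat.gr0I)
  obtain a' where a': "a = p ^ multiplicity p a * a'" "\<not> p dvd a'"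
    using multiplicity_decompose'[OF ne(1,3)] .
  obtain b' where b': "b = p ^ multiplicity p b * b'" "\<not> p dvd b'"
    using multiplicity_decompose'[OF ne(2,3)] .
  show "x \<in> map_prod ((*) (p ^ i)) ((*) (p ^ j)) ` edge_layer p i j E"
    using x a' b' by (intro image_eqI[of _ _ "(a', b')"]) (auto simp: edge_layer_def)
qed

lemma card_edge_layer:
  assumes "prime p" "0 \<notin> A" "0 \<notin> B" "E \<subseteq> A \<times> B"
  shows "card (edge_layer p i j E)
    = card {e \<in> E. multiplicity p (fst e) = i \<and> multiplicity p (snd e) = j}"
  unfolding edge_layer_image[OF assms, symmetric] using assms(1)
  by (intro card_image[symmetric]) (auto simp: inj_on_def)

lemma gcd_prime_power_mult:
  fixes a b p :: nat
  assumes "prime p" "\<not> p dvd a" "\<not> p dvd b"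
  shows "gcd (p ^ i * a) (p ^ j * b) = p ^ min i j * gcd a b"
proof -
  have *: "gcd (p ^ i * a) (p ^ j * b) = p ^ i * gcd a b"
    if "i \<le> j" "\<not> p dvd a" for a b i j
  proof -
    have "p ^ j * b = p ^ i * (p ^ (j - i) * b)"
      using that by (simp flip: power_add mult.assoc)
    hence "gcd (p ^ i * a) (p ^ j * b) = p ^ i * gcd a (p ^ (j - i) * b)"
      by (simp only: gcd_mult_distrib_nat)
    also have "coprime a (p ^ (j - i))"
      using that assms(1) by (simp add: coprime_commute[of a] prime_imp_coprime)
    hence "gcd a (p ^ (j - i) * b) = gcd a b"
      by (rule gcd_mult_right_left_cancel)
    finally show ?thesis .
  qed
  show ?thesis
  proof (cases "i \<le> j")
    case True thus ?thesis using * assms by (simp add: min_def)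
  next
    case False thus ?thesis using *[of j i b a] assms by (simp add: min_def gcd.commute)
  qed
qed

lemma gcd_system_layer:
  assumes G: "gcd_system A B E X Y D" and p: "prime p"
  shows "gcd_system (layer p i A) (layer p j B) (edge_layer p i j E)
     (X / real p ^ i) (Y / real p ^ j) (D / real p ^ min i j)"
proof -
  note D = gcd_systemD[OF G]
  have p0: "p > 0" using p by (simp add: prime_gt_0_nat)
  have fin: "finite (layer p i A)" if "finite A" for i A
  proof (rule finite_imageD)
    show "finite ((*) (p ^ i) ` layer p i A)"
      using that by (rule finite_subset[rotated]) (auto simp: layer_def)
    show "inj_on ((*) (p ^ i)) (layer p i A)" using p0 by (auto simp: inj_on_def)
  qed
  have pos: "0 < a \<and> real a \<le> X / real p ^ i"
    if "a \<in> layer p i A" "\<And>a. a \<in> A \<Longrightarrow> 0 < a" "\<And>a. a \<in> A \<Longrightarrow> real a \<le> X" for a i A X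
    using that(1) that(2)[of "p ^ i * a"] that(3)[of "p ^ i * a"] p0
    by (auto simp: layer_def field_simps)
  have "D / real p ^ min i j \<le> real (gcd a b)" if "(a, b) \<in> edge_layer p i j E" for a b
  proof -
    have "D \<le> real (gcd (p ^ i * a) (p ^ j * b))"
      using that D(12) by (auto simp: edge_layer_def)
    also have "gcd (p ^ i * a) (p ^ j * b) = p ^ min i j * gcd a b"
      using that by (intro gcd_prime_power_mult[OF p]) (auto simp: edge_layer_def)
    finally show ?thesis using p0 by (simp add: field_simps)
  qed
  moreover have "edge_layer p i j E \<subseteq> layer p i A \<times> layer p j B"
    using D(4) by (auto simp: edge_layer_def layer_def)
  ultimately show ?thesis
    unfolding gcd_system_def using D fin pos[of _ i A X] pos[of _ j B Y] p0 by auto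
qed

section \<open>Passing from layer quality to the single-prime inequality\<close>

text \<open>Taking Q-th roots solves the quality inequality for the edge fraction e. It produces the
  kernel of the first section with s = 1 - 1/Q and q = r^(-1/Q).\<close>

lemma powr_bound_of_weighted:
  fixes e z r K Q :: real
  assumes Q: "1 < Q" and e: "0 \<le> e" "z = 0 \<Longrightarrow> e = 0" and z: "0 \<le> z" and r: "0 < r"
    and le: "e powr Q * z powr (1 - Q) * r ^ n \<le> K"
  shows "e \<le> K powr (1 / Q) * (z powr (1 - 1 / Q) * (r powr (- 1 / Q)) ^ n)"
proof (cases "e = 0")
  case True thus ?thesis by simp
next
  case False
  hence ep: "0 < e" and zp: "0 < z" using e z by (auto simp: less_le)
  have "e powr Q = (e powr Q * z powr (1 - Q) * r ^ n) * (z powr (Q - 1) * r powr (- real n))"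
    using ep zp r by (simp add: powr_minus powr_realpow powr_diff field_simps)
  also have "\<dots> \<le> K * (z powr (Q - 1) * r powr (- real n))"
    using le by (intro mult_right_mono) auto
  finally have "(e powr Q) powr (1 / Q) \<le> (K * (z powr (Q - 1) * r powr (- real n))) powr (1 / Q)"
    using Q by (intro powr_mono2) auto
  moreover have "0 \<le> K"
    using le zp r by (meson mult_nonneg_nonneg order_trans powr_ge_zero zero_le_power less_imp_le)
  moreover have "(r powr (- 1 / Q)) ^ n = r powr (- real n * (1 / Q))"
    using r by (simp add: powr_realpow[symmetric] powr_powr)
  moreover have "(Q - 1) * (1 / Q) = 1 - 1 / Q" using Q by (simp add: field_simps)
  ultimately show ?thesis
    using ep zp r Q by (simp add: powr_mult powr_powr)
qed

text \<open>Since |i - j| + 2 min i j = i + j, rescaling X, Y and D multiplies D^2 / (XY) by exactly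
  p^|i-j|.\<close>

lemma quality_layer_eq:
  assumes p: "prime p"
  shows "quality_layer Q p i j A B E X Y D =
     real (card (edge_layer p i j E)) powr Q * real (card (layer p i A) * card (layer p j B)) powr (1 - Q)
      * real p ^ offset i j * (D\<^sup>2 / (X * Y))"
proof -
  have p0: "real p > 0" using p by (simp add: prime_gt_0_nat)
  have "real p ^ offset i j * (real p ^ min i j)\<^sup>2 = real p ^ i * real p ^ j"
  proof -
    have "offset i j + min i j * 2 = i + j" by auto
    thus ?thesis by (metis power_add power_mult)
  qed
  hence *: "(D / real p ^ min i j)\<^sup>2 / ((X / real p ^ i) * (Y / real p ^ j)) = real p ^ offset i j * (D\<^sup>2 / (X * Y))"
    using p0 by (simp add: power_divide divide_simps)
  show ?thesis unfolding quality_layer_def quality_def * by (simp only: mult.assoc)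
qed

text \<open>The quotient of the two qualities depends only on the fractions and on p^|i-j|. The
  factor K is 1 when no layer improves the quality, and 1/L in the proof by contradiction of
  \<open>bounded_loss\<close>.\<close>

lemma edge_fraction_le:
  assumes G: "gcd_system A B E X Y D" and E: "E \<noteq> {}" and p: "prime p" and Q: "1 < Q"
    and le: "quality_layer Q p i j A B E X Y D \<le> K * quality Q A B E X Y D"
  shows "card (edge_layer p i j E) / card E
     \<le> K powr (1 / Q) * (((card (layer p i A) / card A) * (card (layer p j B) / card B)) powr (1 - 1 / Q)
        * (real p powr (- 1 / Q)) ^ offset i j)"
proof -
  note D = gcd_systemD[OF G]
  have AB: "A \<noteq> {}" "B \<noteq> {}" using D(4) E by auto
  have pos: "0 < real (card E)" "0 < real (card A)" "0 < real (card B)"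
    using D(1-3) AB E by (auto simp: card_gt_0_iff)
  have p0: "real p > 0" using p by (simp add: prime_gt_0_nat)
  define e z where "e = card (edge_layer p i j E) / card E"
    and "z = (card (layer p i A) / card A) * (card (layer p j B) / card B)"
  have eq: "quality_layer Q p i j A B E X Y D = (e powr Q * z powr (1 - Q) * real p ^ offset i j) * quality Q A B E X Y D"
    using pos unfolding quality_layer_eq[OF p] quality_def e_def z_def
    by (simp add: powr_divide powr_mult)
  have "0 < quality Q A B E X Y D" using pos D(5-7) by (simp add: quality_def)
  hence *: "e powr Q * z powr (1 - Q) * real p ^ offset i j \<le> K"
    using le unfolding eq by simp
  have fin: "finite (layer p i A)" "finite (layer p j B)"
    and sub: "edge_layer p i j E \<subseteq> layer p i A \<times> layer p j B"
    using gcd_systemD[OF gcd_system_layer[OF G p, of i j]] by auto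
  have "e = 0" if "z = 0"
  proof -
    have "layer p i A = {} \<or> layer p j B = {}"
      using that pos fin by (auto simp: z_def)
    thus ?thesis using sub by (auto simp: e_def)
  qed
  thus ?thesis
    using powr_bound_of_weighted[OF Q _ _ _ p0 *] unfolding e_def z_def by simp
qed

lemma sum_card_fibres:
  assumes "finite S" "finite I" "g ` S \<subseteq> I"
  shows "(\<Sum>i\<in>I. card {a \<in> S. g a = i}) = card S"
  using sum.group[OF assms, of "\<lambda>_. 1::nat"] by simp

text \<open>One index set serves both sides, so that a single exponent k can be compared with both
  ends of an edge.\<close>

definition exponents :: "nat \<Rightarrow> nat set \<Rightarrow> nat set \<Rightarrow> nat set" where
  "exponents p A B = multiplicity p ` (A \<union> B)"

lemma layer_fractions:
  assumes G: "gcd_system A B E X Y D" and E: "E \<noteq> {}" and p: "prime p"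
  shows "finite (exponents p A B)"
    "(\<Sum>i\<in>exponents p A B. card (layer p i A) / card A) = 1"
    "(\<Sum>i\<in>exponents p A B. card (layer p i B) / card B) = 1"
    "(\<Sum>i\<in>exponents p A B. \<Sum>j\<in>exponents p A B. card (edge_layer p i j E) / card E) = 1"
    "\<And>k. (\<Sum>i\<in>exponents p A B - {k}. \<Sum>j\<in>exponents p A B - {k}. card (edge_layer p i j E))
      = card {e \<in> E. multiplicity p (fst e) \<noteq> k \<and> multiplicity p (snd e) \<noteq> k}"
proof -
  note D = gcd_systemD[OF G]
  let ?I = "exponents p A B"
  have z: "0 \<notin> A" "0 \<notin> B" using D(8,10) by auto
  have AB: "A \<noteq> {}" "B \<noteq> {}" using D(4) E by auto
  have pos: "0 < card E" "0 < card A" "0 < card B"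
    using D(1-3) AB E by (auto simp: card_gt_0_iff)
  show fin: "finite ?I" using D by (simp add: exponents_def)
  have "(\<Sum>i\<in>?I. card (layer p i A)) = card A" "(\<Sum>i\<in>?I. card (layer p i B)) = card B"
    using D fin p z by (auto simp: card_layer exponents_def intro!: sum_card_fibres)
  thus "(\<Sum>i\<in>?I. card (layer p i A) / card A) = 1" "(\<Sum>i\<in>?I. card (layer p i B) / card B) = 1"
    using pos by (simp_all flip: sum_divide_distrib of_nat_sum)
  \<comment> \<open>Stated for an arbitrary finite index set: all exponents give the full edge
    count, and all except k give the edges avoiding k at both ends.\<close>
  have edges: "(\<Sum>i\<in>I. \<Sum>j\<in>I. card (edge_layer p i j E)) = card F"
    if F: "F = {e \<in> E. multiplicity p (fst e) \<in> I \<and> multiplicity p (snd e) \<in> I}" and I: "finite I" for F I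
  proof -
    have "(\<Sum>i\<in>I. \<Sum>j\<in>I. card (edge_layer p i j E))
        = (\<Sum>ij\<in>I \<times> I. card {e \<in> F. (multiplicity p (fst e), multiplicity p (snd e)) = ij})"
      unfolding sum.cartesian_product
      by (intro sum.cong refl) (auto simp: card_edge_layer[OF p z D(4)] F intro!: arg_cong[of _ _ card])
    also have "\<dots> = card F"
      using I D(3) F by (intro sum_card_fibres) auto
    finally show ?thesis .
  qed
  have all: "multiplicity p (fst e) \<in> ?I" "multiplicity p (snd e) \<in> ?I" if "e \<in> E" for e
    using that D(4) by (auto simp: exponents_def)
  have "(\<Sum>i\<in>?I. \<Sum>j\<in>?I. card (edge_layer p i j E)) = card E"
    using all fin by (intro edges) auto
  thus "(\<Sum>i\<in>?I. \<Sum>j\<in>?I. card (edge_layer p i j E) / card E) = 1"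
    using pos by (simp flip: sum_divide_distrib of_nat_sum)
  show "(\<Sum>i\<in>?I - {k}. \<Sum>j\<in>?I - {k}. card (edge_layer p i j E))
      = card {e \<in> E. multiplicity p (fst e) \<noteq> k \<and> multiplicity p (snd e) \<noteq> k}" for k
    using all fin by (intro edges) auto
qed

text \<open>This is \<open>local_concentration\<close> with s = 1 - 1/Q and q = p^(-1/Q). Then
  2s/(1-s) = 2(Q-1), so the power of q becomes p^(2/Q-2); for Q > 2 that exponent is below -1, hence
  summable over p.\<close>

lemma improve_or_concentrate:
  fixes Q :: real
  assumes Q: "2 < Q"
  obtains P0 :: nat where
    "\<And>A B E X Y D p. gcd_system A B E X Y D \<Longrightarrow> E \<noteq> {} \<Longrightarrow> prime p \<Longrightarrow> P0 \<le> p \<Longrightarrow>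
      (\<And>i j. quality_layer Q p i j A B E X Y D \<le> quality Q A B E X Y D) \<Longrightarrow>
      \<exists>k. real (card {e \<in> E. multiplicity p (fst e) \<noteq> k \<and> multiplicity p (snd e) \<noteq> k})
        \<le> 3 * 64 powr (2 * (Q - 1)) * real p powr (2 / Q - 2) * card E"
proof -
  define s where "s = 1 - 1 / Q"
  have s: "1/2 < s" "s < 1" using Q by (auto simp: s_def field_simps)
  obtain q0 where q0: "0 < q0" and conc:
    "\<And>(I :: nat set) \<alpha> \<beta> e q. finite I \<Longrightarrow> (\<And>i. i \<in> I \<Longrightarrow> 0 \<le> \<alpha> i) \<Longrightarrow> sum \<alpha> I = 1 \<Longrightarrow>
      (\<And>i. i \<in> I \<Longrightarrow> 0 \<le> \<beta> i) \<Longrightarrow> sum \<beta> I = 1 \<Longrightarrow> 0 < q \<Longrightarrow> q \<le> q0 \<Longrightarrow>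
      (\<Sum>i\<in>I. \<Sum>j\<in>I. e i j) = 1 \<Longrightarrow>
      (\<And>i j. i \<in> I \<Longrightarrow> j \<in> I \<Longrightarrow> e i j \<le> (\<alpha> i * \<beta> j) powr s * q ^ offset i j) \<Longrightarrow>
      \<exists>k\<in>I. (\<Sum>i\<in>I - {k}. \<Sum>j\<in>I - {k}. e i j) \<le> 3 * (64 * q) powr (2 * s / (1 - s))"
    by (rule local_concentration[OF s]) blast
  \<comment> \<open>From this point on p^(-1/Q) is at most q0.\<close>
  define P0 where "P0 = nat \<lceil>q0 powr (- Q)\<rceil>"
  show ?thesis
  proof (rule that[of P0])
    fix A B E X Y D p
    assume G: "gcd_system A B E X Y D" and E: "E \<noteq> {}" and p: "prime p" "P0 \<le> p"
      and le: "\<And>i j. quality_layer Q p i j A B E X Y D \<le> quality Q A B E X Y D"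
    have p0: "real p > 0" using p by (simp add: prime_gt_0_nat)
    have "q0 powr (- Q) \<le> real p"
      using p(2) unfolding P0_def by linarith
    hence "real p powr (- 1 / Q) \<le> (q0 powr (- Q)) powr (- 1 / Q)"
      using q0 Q by (intro powr_mono2') auto
    also have "\<dots> = q0" using q0 Q by (simp add: powr_powr)
    finally have q: "real p powr (- 1 / Q) \<le> q0" .
    note L = layer_fractions[OF G E p(1)]
    have frac: "card (edge_layer p i j E) / card E
     \<le> ((card (layer p i A) / card A) * (card (layer p j B) / card B)) powr s
        * (real p powr (- 1 / Q)) ^ offset i j" for i j
      using edge_fraction_le[OF G E p(1), of Q i j 1] le Q by (simp add: s_def)
    have "\<exists>k\<in>exponents p A B. (\<Sum>i\<in>exponents p A B - {k}. \<Sum>j\<in>exponents p A B - {k}. card (edge_layer p i j E) / card E)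
        \<le> 3 * (64 * real p powr (- 1 / Q)) powr (2 * s / (1 - s))"
      using q p0 L(1-4) frac by (intro conc[where \<alpha> = "\<lambda>i. card (layer p i A) / card A"
          and \<beta> = "\<lambda>i. card (layer p i B) / card B"]) auto
    then obtain k where k: "(\<Sum>i\<in>exponents p A B - {k}. \<Sum>j\<in>exponents p A B - {k}. card (edge_layer p i j E) / card E)
        \<le> 3 * (64 * real p powr (- 1 / Q)) powr (2 * s / (1 - s))" by blast
    have "2 * s / (1 - s) = 2 * (Q - 1)" using Q by (simp add: s_def field_simps)
    moreover have "- 1 / Q * (2 * (Q - 1)) = 2 / Q - 2" using Q by (simp add: field_simps)
    ultimately have c: "3 * (64 * real p powr (- 1 / Q)) powr (2 * s / (1 - s))
        = 3 * 64 powr (2 * (Q - 1)) * real p powr (2 / Q - 2)"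
      using p0 by (simp add: powr_mult powr_powr)
    have "real (card {e \<in> E. multiplicity p (fst e) \<noteq> k \<and> multiplicity p (snd e) \<noteq> k}) / card E
      = (\<Sum>i\<in>exponents p A B - {k}. \<Sum>j\<in>exponents p A B - {k}. card (edge_layer p i j E) / card E)"
      unfolding L(5)[symmetric] by (simp add: sum_divide_distrib)
    hence "real (card {e \<in> E. multiplicity p (fst e) \<noteq> k \<and> multiplicity p (snd e) \<noteq> k}) / card E
       \<le> 3 * 64 powr (2 * (Q - 1)) * real p powr (2 / Q - 2)" using k c by simp
    moreover have "0 < real (card E)" using E gcd_systemD(3)[OF G] by (simp add: card_gt_0_iff)
    ultimately show "\<exists>k. real (card {e \<in> E. multiplicity p (fst e) \<noteq> k \<and> multiplicity p (snd e) \<noteq> k})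
        \<le> 3 * 64 powr (2 * (Q - 1)) * real p powr (2 / Q - 2) * card E"
      by (auto simp: divide_le_eq)
  qed
qed

text \<open>If every layer had quality below 1/L of the whole, the kernel bound would make the edge
  fractions sum to at most 1/2, whereas they sum to 1.\<close>

lemma bounded_loss:
  fixes Q :: real
  assumes Q: "2 < Q"
  obtains L :: real where "1 \<le> L"
    "\<And>A B E X Y D p. gcd_system A B E X Y D \<Longrightarrow> E \<noteq> {} \<Longrightarrow> prime p \<Longrightarrow>
      \<exists>i j. quality Q A B E X Y D \<le> L * quality_layer Q p i j A B E X Y D"
proof -
  \<comment> \<open>The largest ratio p^(-1/Q) occurs at p = 2, which makes the constants uniform in
    p. M is twice the resulting kernel norm, and L = M^Q because a Q-th root is taken.\<close>
  define r :: real where "r = 2 powr (- 1 / Q)"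
  have r: "0 < r" "r < 1" using Q by (auto simp: r_def intro!: powr_less_one)
  define M where "M = 2 * (1 + 2 * r / (1 - r))"
  have M: "2 \<le> M" using r by (simp add: M_def)
  define L where "L = M powr Q"
  have L: "1 \<le> L" using M Q by (simp add: L_def ge_one_powr_ge_zero)
  show ?thesis
  proof (rule that[OF L], rule ccontr)
    fix A B E X Y D p
    assume G: "gcd_system A B E X Y D" and E: "E \<noteq> {}" and p: "prime p"
      and "\<nexists>i j. quality Q A B E X Y D \<le> L * quality_layer Q p i j A B E X Y D"
    hence le: "quality_layer Q p i j A B E X Y D \<le> (1 / L) * quality Q A B E X Y D" for i j
      using L by (simp add: field_simps) (metis linorder_le_less_linear order_less_imp_le mult.commute)
    note F = layer_fractions[OF G E p]
    let ?I = "exponents p A B"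
    define q where "q = real p powr (- 1 / Q)"
    have q: "0 \<le> q" "q \<le> r"
      unfolding q_def r_def using p Q prime_ge_2_nat[OF p] by (auto intro!: powr_mono2')
    have LM: "(1 / L) powr (1 / Q) = 1 / M"
      using M Q by (simp add: L_def powr_divide powr_powr)
    have "(\<Sum>i\<in>?I. \<Sum>j\<in>?I. card (edge_layer p i j E) / card E)
       \<le> (\<Sum>i\<in>?I. \<Sum>j\<in>?I. (1 / M) * (((card (layer p i A) / card A) * (card (layer p j B) / card B)) powr (1 - 1 / Q) * q ^ offset i j))"
      unfolding q_def LM[symmetric] using Q by (intro sum_mono edge_fraction_le[OF G E p _ le]) auto
    also have "\<dots> = (1 / M) * (\<Sum>i\<in>?I. \<Sum>j\<in>?I. ((card (layer p i A) / card A) * (card (layer p j B) / card B)) powr (1 - 1 / Q) * q ^ offset i j)"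
      by (simp only: sum_distrib_left)
    also have "\<dots> \<le> (1 / M) * ((1 * 1) powr (1 - 1 / Q) * (1 + 2 * q / (1 - q)))"
      using M Q q r F(1-3) sum_offset_kernel_le[of ?I "\<lambda>i. card (layer p i A) / card A"
          "\<lambda>j. card (layer p j B) / card B" "1 - 1 / Q" q]
      by (intro mult_left_mono) (auto simp: field_simps)
    also have "\<dots> \<le> (1 / M) * (M / 2)"
      using M q r by (intro mult_left_mono) (auto simp: M_def intro!: frac_le)
    also have "\<dots> = 1 / 2" using M by simp
    finally show False using F(4) by simp
  qed
qed

section \<open>Counting around a centre\<close>

lemma card_multiples_le:
  fixes m :: nat and X :: real
  assumes m: "0 < m" and X: "0 \<le> X" and S: "\<And>a. a \<in> S \<Longrightarrow> 0 < a \<and> real a \<le> X \<and> m dvd a"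
  shows "real (card S) \<le> X / m"
proof -
  have "S \<subseteq> (*) m ` {1..nat \<lfloor>X / m\<rfloor>}"
  proof
    fix a assume "a \<in> S"
    then obtain c where c: "a = m * c" "0 < a" "real a \<le> X" using S by blast
    hence "real c \<le> X / m" using m by (simp add: field_simps)
    hence "c \<le> nat \<lfloor>X / m\<rfloor>" by (simp add: le_nat_floor)
    thus "a \<in> (*) m ` {1..nat \<lfloor>X / m\<rfloor>}" using c by auto
  qed
  hence "card S \<le> nat \<lfloor>X / m\<rfloor>"
    by (metis card_atLeastAtMost card_image_le card_mono diff_Suc_1 finite_atLeastAtMost finite_imageI order_trans)
  moreover have "real (nat \<lfloor>X / m\<rfloor>) \<le> X / m" using X m by simp
  ultimately show ?thesis by linarith
qed

text \<open>If N / gcd(a,N) = n, then a is a multiple of N/n, which leaves at most Xn/N choices.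
  Each n is at most V and there are at most V values of n.\<close>

lemma card_small_cofactor_le:
  fixes N :: nat and X V :: real
  assumes N: "0 < N" and X: "0 < X" and V: "0 \<le> V" and A: "\<And>a. a \<in> A \<Longrightarrow> 0 < a \<and> real a \<le> X"
  shows "real (card {a \<in> A. real (N div gcd a N) \<le> V}) \<le> X * V\<^sup>2 / N"
proof -
  define u where "u = nat \<lfloor>V\<rfloor>"
  have uV: "real u \<le> V" using V by (simp add: u_def)
  have "A \<subseteq> {..nat \<lfloor>X\<rfloor>}" using A by (auto simp: le_nat_floor)
  hence fin: "finite A" by (rule finite_subset) auto
  have "{a \<in> A. real (N div gcd a N) \<le> V} \<subseteq> (\<Union>n\<in>{1..u}. {a \<in> A. N div gcd a N = n})"
    using N by (auto simp: u_def le_nat_floor Suc_le_eq div_greater_zero_iff intro!: gcd_le2_nat)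
  hence "card {a \<in> A. real (N div gcd a N) \<le> V} \<le> card (\<Union>n\<in>{1..u}. {a \<in> A. N div gcd a N = n})"
    using fin by (intro card_mono) auto
  also have "\<dots> \<le> (\<Sum>n\<in>{1..u}. card {a \<in> A. N div gcd a N = n})"
    by (rule card_UN_le) auto
  finally have "real (card {a \<in> A. real (N div gcd a N) \<le> V})
      \<le> (\<Sum>n\<in>{1..u}. real (card {a \<in> A. N div gcd a N = n}))"
    by (simp flip: of_nat_sum)
  also have "\<dots> \<le> (\<Sum>n\<in>{1..u}. X * V / N)"
  proof (rule sum_mono)
    fix n assume n: "n \<in> {1..u}"
    show "real (card {a \<in> A. N div gcd a N = n}) \<le> X * V / N"
    proof (cases "n dvd N")
      case True
      then obtain m where m: "N = n * m" by blast
      have m0: "0 < m" using N m by simp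
      have "real (card {a \<in> A. N div gcd a N = n}) \<le> X / m"
      proof (rule card_multiples_le)
        fix a assume a: "a \<in> {a \<in> A. N div gcd a N = n}"
        have "N = n * gcd a N" using a by auto
        hence "gcd a N = m" using m n by (metis atLeastAtMost_iff mult_cancel1 not_one_le_zero)
        hence "m dvd a" by (metis gcd_dvd1)
        thus "0 < a \<and> real a \<le> X \<and> m dvd a" using A a by auto
      qed (use m0 X in auto)
      also have "\<dots> = X * n / N" using m m0 n by (simp add: field_simps)
      also have "\<dots> \<le> X * V / N"
        using X n uV by (intro divide_right_mono mult_left_mono) auto
      finally show ?thesis .
    next
      case False
      hence "{a \<in> A. N div gcd a N = n} = {}"
        by (auto simp: div_dvd_iff_mult N)
      hence "card {a \<in> A. N div gcd a N = n} = 0" by (simp only: card.empty)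
      thus ?thesis using X V by simp
    qed
  qed
  also have "\<dots> = u * (X * V / N)" by simp
  also have "\<dots> \<le> V * (X * V / N)" using uV X V by (intro mult_right_mono) auto
  finally show ?thesis by (simp add: power2_eq_square mult_ac)
qed

text \<open>Compare exponents of p. If a has the same exponent v as N and b has exponent w, the
  product has exponent min v w + 0 + (v - min v w) = v; the other case is symmetric.\<close>

lemma cofactors_dvd:
  fixes a b N :: nat
  assumes N: "0 < N" and ab: "0 < a" "0 < b"
    and val: "\<And>p. prime p \<Longrightarrow> multiplicity p a = multiplicity p N \<or> multiplicity p b = multiplicity p N"
  shows "gcd a b * (N div gcd a N) * (N div gcd b N) dvd N"
proof -
  define na nb where "na = N div gcd a N" and "nb = N div gcd b N"
  have Na: "N = gcd a N * na" and Nb: "N = gcd b N * nb" by (simp_all add: na_def nb_def)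
  have pos: "na \<noteq> 0" "nb \<noteq> 0" using N Na Nb by (metis mult_0_right less_irrefl)+
  have "gcd a b * na * nb dvd N"
  proof (rule multiplicity_le_imp_dvd)
    fix p :: nat assume p: "prime p"
    have pe: "prime_elem p" using p by simp
    have "multiplicity p N = min (multiplicity p a) (multiplicity p N) + multiplicity p na"
      using Na pos ab N p by (metis gcd_eq_0_iff less_irrefl multiplicity_gcd pe prime_elem_multiplicity_mult_distrib)
    moreover have "multiplicity p N = min (multiplicity p b) (multiplicity p N) + multiplicity p nb"
      using Nb pos ab N p by (metis gcd_eq_0_iff less_irrefl multiplicity_gcd pe prime_elem_multiplicity_mult_distrib)
    moreover have "multiplicity p (gcd a b * na * nb)
        = min (multiplicity p a) (multiplicity p b) + multiplicity p na + multiplicity p nb"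
      using pos ab p multiplicity_gcd[of a b p]
      by (simp add: prime_elem_multiplicity_mult_distrib[OF pe])
    ultimately show "multiplicity p (gcd a b * na * nb) \<le> multiplicity p N"
      using val[OF p] by auto
  qed (use pos ab in auto)
  thus ?thesis by (simp add: na_def nb_def)
qed

text \<open>With $n_a = N / \gcd(a, N)$ the edges of \<open>F\<close> satisfy $D n_a n_b \le N$. Splitting them at one
  optimally chosen threshold for $n_b$ avoids the logarithm of a dyadic decomposition.\<close>

lemma card_edges_le_of_centre:
  assumes G: "gcd_system A B E X Y D" and N: "0 < N"
    and F: "F \<subseteq> E" "real (card E) \<le> 2 * card F"
    and val: "\<And>a b p. (a, b) \<in> F \<Longrightarrow> prime p \<Longrightarrow>
      multiplicity p a = multiplicity p N \<or> multiplicity p b = multiplicity p N"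
  shows "(real (card E))\<^sup>2 * D\<^sup>2 \<le> 16 * (X * Y * (real (card A) * real (card B)))"
proof (cases "E = {}")
  case True
  thus ?thesis using gcd_systemD(5-7)[OF G] by simp
next
  case False
  note d = gcd_systemD[OF G]
  have AB: "0 < real (card A)" "0 < real (card B)"
    using d(1,2,4) False by (auto simp: card_gt_0_iff)
  define na where "na a = real (N div gcd a N)" for a
  define T where "T = N / D"
  have T: "0 < T" using N d by (simp add: T_def)
  \<comment> \<open>This V balances the two counts |A| Y V^2 / N and |B| X (T/V)^2 / N obtained
    below.\<close>
  define V where "V = sqrt (T * sqrt ((card B * X) / (card A * Y)))"
  have V: "0 < V" "V\<^sup>2 = T * sqrt ((card B * X) / (card A * Y))"
    using T AB d by (auto simp: V_def)
  have prod: "na a * na b \<le> T" if "(a, b) \<in> F" for a b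
  proof -
    have ab: "0 < a" "0 < b" "D \<le> real (gcd a b)" using that F(1) d by auto
    have "gcd a b * (N div gcd a N) * (N div gcd b N) \<le> N"
      using val[OF that] N ab by (intro dvd_imp_le cofactors_dvd) auto
    hence "real (gcd a b) * na a * na b \<le> N"
      unfolding na_def by (metis of_nat_le_iff of_nat_mult)
    moreover have "D * (na a * na b) \<le> real (gcd a b) * (na a * na b)"
      using ab by (intro mult_right_mono) (auto simp: na_def)
    ultimately show ?thesis using d(7) by (simp add: T_def field_simps)
  qed
  \<comment> \<open>As \<open>na a * na b\<close> is at most T, either the cofactor of b is at most
    V or that of a is at most T/V.\<close>
  have "F \<subseteq> A \<times> {b \<in> B. na b \<le> V} \<union> {a \<in> A. na a \<le> T / V} \<times> B"
  proof
    fix x assume x: "x \<in> F"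
    obtain a b where ab: "x = (a, b)" by (cases x)
    have mem: "a \<in> A" "b \<in> B" using x ab F(1) d(4) by auto
    have "na a \<le> T / V" if "V < na b"
    proof -
      have "na a * V \<le> na a * na b" using that by (intro mult_left_mono) (auto simp: na_def)
      also have "\<dots> \<le> T" using prod x ab by simp
      finally show ?thesis using V by (simp add: field_simps)
    qed
    thus "x \<in> A \<times> {b \<in> B. na b \<le> V} \<union> {a \<in> A. na a \<le> T / V} \<times> B"
      using mem ab by fastforce
  qed
  hence "card F \<le> card (A \<times> {b \<in> B. na b \<le> V} \<union> {a \<in> A. na a \<le> T / V} \<times> B)"
    using d by (intro card_mono) auto
  also have "\<dots> \<le> card A * card {b \<in> B. na b \<le> V} + card {a \<in> A. na a \<le> T / V} * card B"
    by (rule order_trans[OF card_Un_le]) (simp add: card_cartesian_product)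
  finally have "real (card F) \<le> card A * real (card {b \<in> B. na b \<le> V}) + real (card {a \<in> A. na a \<le> T / V}) * card B"
    by (simp flip: of_nat_mult of_nat_add)
  also have "\<dots> \<le> card A * (Y * V\<^sup>2 / N) + (X * (T / V)\<^sup>2 / N) * card B"
    unfolding na_def using N V T d
    by (intro add_mono mult_left_mono mult_right_mono card_small_cofactor_le) auto
  also have "\<dots> = 2 * sqrt (X * Y * (real (card A) * real (card B))) / D"
  proof -
    \<comment> \<open>This is V^2 / T, the ratio at which both summands agree.\<close>
    define \<rho> where "\<rho> = sqrt ((card B * X) / (card A * Y))"
    have \<rho>: "0 < \<rho>" "\<rho>\<^sup>2 = (card B * X) / (card A * Y)" using AB d by (auto simp: \<rho>_def)
    have 1: "card A * Y * \<rho> = sqrt (X * Y * (real (card A) * real (card B)))"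
    proof (rule real_sqrt_unique[symmetric])
      have "(card A * Y * \<rho>)\<^sup>2 = (card A * Y)\<^sup>2 * \<rho>\<^sup>2" by (simp add: power_mult_distrib)
      also have "\<dots> = X * Y * (real (card A) * real (card B))"
        unfolding \<rho>(2) using AB d by (simp add: power2_eq_square field_simps)
      finally show "(card A * Y * \<rho>)\<^sup>2 = X * Y * (real (card A) * real (card B))" .
    qed (use AB d \<rho> in auto)
    have 2: "X * card B / \<rho> = card A * Y * \<rho>"
    proof -
      have "card A * Y * \<rho> * \<rho> = card A * Y * \<rho>\<^sup>2" by (simp add: power2_eq_square)
      also have "\<dots> = X * card B" unfolding \<rho>(2) using AB d(6) by simp
      finally show ?thesis using \<rho>(1) by (simp add: field_simps)
    qed
    have "X * (T / V)\<^sup>2 / N * card B = (X * card B / \<rho>) * (T / N)"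
      using V T by (simp add: power_divide \<rho>_def[symmetric] power2_eq_square[of T])
    also have "\<dots> = (card A * Y * \<rho>) * (T / N)" by (simp only: 2)
    finally have "X * (T / V)\<^sup>2 / N * card B = (card A * Y * \<rho>) * (T / N)" .
    moreover have "card A * (Y * V\<^sup>2 / N) = (card A * Y * \<rho>) * (T / N)"
      unfolding V(2) \<rho>_def[symmetric] by (simp add: mult_ac)
    ultimately have "card A * (Y * V\<^sup>2 / N) + (X * (T / V)\<^sup>2 / N) * card B = 2 * (card A * Y * \<rho>) * (T / N)"
      by linarith
    thus ?thesis unfolding 1 using N by (simp add: T_def)
  qed
  finally have "real (card F) * D \<le> 2 * sqrt (X * Y * (real (card A) * real (card B)))"
    using d(7) by (simp add: field_simps)
  moreover have "real (card E) * D \<le> 2 * (real (card F) * D)"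
    using mult_right_mono[OF F(2), of D] d(7) by simp
  ultimately have "real (card E) * D \<le> 4 * sqrt (X * Y * (real (card A) * real (card B)))"
    by linarith
  hence "(real (card E) * D)\<^sup>2 \<le> (4 * sqrt (X * Y * (real (card A) * real (card B))))\<^sup>2"
    using d(7) by (intro power_mono) auto
  thus ?thesis using d(5,6) by (simp add: power_mult_distrib)
qed

text \<open>The quality is the quotient bounded by C times the edge density to the power Q - 2, and
  the density is at most 1.\<close>

lemma quality_le:
  assumes G: "gcd_system A B E X Y D" and Q: "2 \<le> Q"
    and le: "(real (card E))\<^sup>2 * D\<^sup>2 \<le> C * (X * Y * (real (card A) * real (card B)))" and C: "0 \<le> C"
  shows "quality Q A B E X Y D \<le> C"
proof (cases "E = {}")
  case True
  thus ?thesis using C by (simp add: quality_def)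
next
  case False
  note d = gcd_systemD[OF G]
  have pos: "0 < real (card E)" "0 < real (card A)" "0 < real (card B)"
    using d(1-4) False by (auto simp: card_gt_0_iff)
  define P where "P = real (card A) * real (card B)"
  have P: "0 < P" using pos by (simp add: P_def)
  have "card E \<le> card A * card B"
    using d(1,2,4) by (metis card_cartesian_product card_mono finite_cartesian_product)
  hence "card E / P \<le> 1" using P unfolding P_def by (simp flip: of_nat_mult)
  hence "(card E / P) powr (Q - 2) \<le> 1" using P Q by (intro powr_le1) auto
  moreover have "quality Q A B E X Y D = ((real (card E))\<^sup>2 * D\<^sup>2 / (X * Y * P)) * (card E / P) powr (Q - 2)"
  proof -
    have "real (card E) powr Q = (real (card E))\<^sup>2 * real (card E) powr (Q - 2)"
      using pos by (simp add: powr_diff)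
    moreover have "P powr (1 - Q) = 1 / (P * P powr (Q - 2))"
      using P by (simp add: powr_diff field_simps power2_eq_square)
    ultimately show ?thesis using P pos by (simp add: quality_def P_def[symmetric] powr_divide mult_ac)
  qed
  moreover have "(real (card E))\<^sup>2 * D\<^sup>2 / (X * Y * P) \<le> C"
    using le d P unfolding P_def[symmetric] by (simp add: divide_le_eq)
  moreover have "0 \<le> (real (card E))\<^sup>2 * D\<^sup>2 / (X * Y * P)" using d P by simp
  ultimately show ?thesis
    by (metis mult_right_le_one_le order_trans powr_ge_zero)
qed

section \<open>Removing primes one at a time\<close>

definition prime_support :: "nat set \<Rightarrow> nat set \<Rightarrow> nat set" where
  "prime_support A B = {p. prime p \<and> (\<exists>a\<in>A \<union> B. p dvd a)}"

lemma finite_prime_support: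
  assumes "gcd_system A B E X Y D"
  shows "finite (prime_support A B)"
proof -
  have "prime_support A B \<subseteq> (\<Union>a\<in>A \<union> B. {p. p dvd a})" by (auto simp: prime_support_def)
  moreover have "finite (\<Union>a\<in>A \<union> B. {p. p dvd a})"
    using gcd_systemD(1,2,8,10)[OF assms] by (auto intro!: finite_divisors_nat)
  ultimately show ?thesis by (rule finite_subset)
qed

lemma prime_support_layer: "prime_support (layer p i A) (layer p j B) \<subseteq> prime_support A B - {p}"
proof
  fix r assume "r \<in> prime_support (layer p i A) (layer p j B)"
  then obtain a where r: "prime r" "r dvd a" "\<not> p dvd a" "p ^ i * a \<in> A \<or> p ^ j * a \<in> B"
    by (auto simp: prime_support_def layer_def)
  thus "r \<in> prime_support A B - {p}"
    unfolding prime_support_def by (auto intro: dvd_mult)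
qed

text \<open>The centre N has exponent k p at each p of the support. By the union bound at least half
  of the edges agree with N at one end for every such p; at all other primes every exponent is 0.
  Then \<open>card_edges_le_of_centre\<close> applies.\<close>

lemma quality_le_of_concentrated:
  fixes c :: "nat \<Rightarrow> real"
  assumes G: "gcd_system A B E X Y D" and Q: "2 \<le> Q"
    and k: "\<And>p. p \<in> prime_support A B \<Longrightarrow>
      real (card {e \<in> E. multiplicity p (fst e) \<noteq> k p \<and> multiplicity p (snd e) \<noteq> k p}) \<le> c p * card E"
    and c: "sum c (prime_support A B) \<le> 1 / 2"
  shows "quality Q A B E X Y D \<le> 16"
proof -
  note d = gcd_systemD[OF G]
  define S where "S = prime_support A B"
  have fin: "finite S" using finite_prime_support[OF G] by (simp add: S_def)
  have S: "prime p" if "p \<in> S" for p using that by (simp add: S_def prime_support_def)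
  define N where "N = (\<Prod>p\<in>S. p ^ k p)"
  have N: "0 < N" unfolding N_def using S by (intro prod_pos) (simp add: prime_gt_0_nat)
  have mult: "multiplicity p N = (if p \<in> S then k p else 0)" if "prime p" for p
    unfolding N_def using fin S that by (intro multiplicity_prod_prime_powers) auto
  define bad where "bad p = {e \<in> E. multiplicity p (fst e) \<noteq> k p \<and> multiplicity p (snd e) \<noteq> k p}" for p
  define F where "F = E - (\<Union>p\<in>S. bad p)"
  have "real (card (\<Union>p\<in>S. bad p)) \<le> (\<Sum>p\<in>S. real (card (bad p)))"
    using card_UN_le[OF fin, of bad] by (simp flip: of_nat_sum)
  also have "\<dots> \<le> (\<Sum>p\<in>S. c p * card E)"
    using k by (intro sum_mono) (auto simp: bad_def S_def)
  also have "\<dots> = sum c S * card E" by (simp add: sum_distrib_right)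
  also have "\<dots> \<le> (1 / 2) * card E" using c by (intro mult_right_mono) (auto simp: S_def)
  finally have "real (card (\<Union>p\<in>S. bad p)) \<le> (1 / 2) * card E" .
  moreover have "card E = card F + card (\<Union>p\<in>S. bad p)"
  proof -
    have "(\<Union>p\<in>S. bad p) \<subseteq> E" by (auto simp: bad_def)
    thus ?thesis unfolding F_def using d(3)
      by (metis card_Diff_subset card_mono finite_subset le_add_diff_inverse2)
  qed
  ultimately have half: "real (card E) \<le> 2 * card F" by simp
  have "multiplicity p a = multiplicity p N \<or> multiplicity p b = multiplicity p N"
    if "(a, b) \<in> F" "prime p" for a b p
  proof (cases "p \<in> S")
    case True
    thus ?thesis using that by (auto simp: mult F_def bad_def)
  next
    case False
    hence "\<not> p dvd a" using that d(4) by (auto simp: F_def S_def prime_support_def)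
    thus ?thesis using False that by (simp add: mult not_dvd_imp_multiplicity_0)
  qed
  hence "(real (card E))\<^sup>2 * D\<^sup>2 \<le> 16 * (X * Y * (real (card A) * real (card B)))"
    using half by (intro card_edges_le_of_centre[OF G N, of F]) (auto simp: F_def)
  thus ?thesis by (intro quality_le[OF G Q]) auto
qed

lemma exists_small_tail:
  fixes C t :: real
  assumes "t < - 1" "0 \<le> C"
  obtains P :: nat where
    "\<And>S. finite S \<Longrightarrow> (\<And>n. n \<in> S \<Longrightarrow> P \<le> n) \<Longrightarrow> (\<Sum>n\<in>S. C * real n powr t) \<le> 1 / 2"
proof -
  let ?f = "\<lambda>n. C * real n powr t"
  have sum: "summable ?f"
    using assms by (intro summable_mult) (simp add: summable_real_powr_iff)
  then obtain P where P: "norm (\<Sum>i. ?f (i + P)) < 1 / 2"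
    using suminf_exist_split[of "1 / 2" ?f] by auto
  show ?thesis
  proof (rule that[of P])
    fix S :: "nat set" assume S: "finite S" "\<And>n. n \<in> S \<Longrightarrow> P \<le> n"
    \<comment> \<open>Shifting by P places S inside the index range of the tail series, which starts
      at 0.\<close>
    have "inj_on (\<lambda>n. n - P) S" using S(2) by (auto simp: inj_on_def) (metis le_add_diff_inverse2)
    hence "(\<Sum>m\<in>(\<lambda>n. n - P) ` S. ?f (m + P)) = (\<Sum>n\<in>S. ?f (n - P + P))"
      by (simp add: sum.reindex)
    also have "\<dots> = sum ?f S"
      using S(2) by (intro sum.cong refl) (simp only: le_add_diff_inverse2)
    finally have "sum ?f S = (\<Sum>m\<in>(\<lambda>n. n - P) ` S. ?f (m + P))" by simp
    also have "\<dots> \<le> (\<Sum>i. ?f (i + P))"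
      using S(1) assms(2) summable_ignore_initial_segment[OF sum] by (intro sum_le_suminf) auto
    finally show "sum ?f S \<le> 1 / 2" using P by simp
  qed
qed

text \<open>Induction on the number of primes dividing some vertex. The constant L is paid only for
  primes below a fixed P0, so the total loss is at most L^P0 however many primes occur.\<close>

lemma quality_bounded:
  fixes Q :: real
  assumes Q: "2 < Q"
  obtains C :: real where "0 < C"
    "\<And>A B E X Y D. gcd_system A B E X Y D \<Longrightarrow> quality Q A B E X Y D \<le> C"
proof -
  obtain L where L: "1 \<le> L" "\<And>A B E X Y D p. gcd_system A B E X Y D \<Longrightarrow> E \<noteq> {} \<Longrightarrow> prime p \<Longrightarrow>
      \<exists>i j. quality Q A B E X Y D \<le> L * quality_layer Q p i j A B E X Y D"
    using bounded_loss[OF Q] by blast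
  define c where "c p = 3 * 64 powr (2 * (Q - 1)) * real p powr (2 / Q - 2)" for p :: nat
  obtain P1 :: nat where P1: "\<And>A B E X Y D p. gcd_system A B E X Y D \<Longrightarrow> E \<noteq> {} \<Longrightarrow> prime p \<Longrightarrow> P1 \<le> p \<Longrightarrow>
      (\<And>i j. quality_layer Q p i j A B E X Y D \<le> quality Q A B E X Y D) \<Longrightarrow>
      \<exists>k. real (card {e \<in> E. multiplicity p (fst e) \<noteq> k \<and> multiplicity p (snd e) \<noteq> k}) \<le> c p * card E"
    unfolding c_def using improve_or_concentrate[OF Q] by blast
  have "2 / Q - 2 < - 1" using Q by (simp add: field_simps)
  then obtain P2 :: nat where P2: "\<And>S. finite S \<Longrightarrow> (\<And>n. n \<in> S \<Longrightarrow> P2 \<le> n) \<Longrightarrow> sum c S \<le> 1 / 2"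
    using exists_small_tail[of "2 / Q - 2" "3 * 64 powr (2 * (Q - 1))"] unfolding c_def by auto
  \<comment> \<open>Beyond P1 concentration is available, and beyond P2 the exceptional fractions
    sum to at most 1/2.\<close>
  define P0 where "P0 = max P1 P2"
  have main: "quality Q A B E X Y D \<le> 16 * L ^ card (prime_support A B \<inter> {..<P0})"
    if "gcd_system A B E X Y D" for A B E X Y D
    using that
  proof (induction "card (prime_support A B)" arbitrary: A B E X Y D rule: less_induct)
    case less
    note G = less.prems
    let ?S = "prime_support A B"
    note fin = finite_prime_support[OF G]
    have IH: "quality_layer Q p i j A B E X Y D \<le> 16 * L ^ card (?S \<inter> {..<P0} - {p})"
      if p: "p \<in> ?S" for p i j
    proof -
      note sub = prime_support_layer[of p i A j B]
      have "card (prime_support (layer p i A) (layer p j B)) < card ?S"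
        using p sub fin by (intro psubset_card_mono) auto
      hence "quality_layer Q p i j A B E X Y D
          \<le> 16 * L ^ card (prime_support (layer p i A) (layer p j B) \<inter> {..<P0})"
        unfolding quality_layer_def using p
        by (intro less.hyps gcd_system_layer[OF G]) (auto simp: prime_support_def)
      also have "\<dots> \<le> 16 * L ^ card (?S \<inter> {..<P0} - {p})"
        using L(1) sub fin by (intro mult_left_mono power_increasing card_mono) auto
      finally show ?thesis .
    qed
    have L16: "16 \<le> 16 * L ^ n" for n using L(1) by simp
    \<comment> \<open>Either there are no edges, or a small prime is removed at cost L, or a large
      prime is removed without loss, or all primes are large and none improves the quality. In the
      last case concentration holds at every prime of the support.\<close>
    consider "E = {}" | p where "E \<noteq> {}" "p \<in> ?S" "p < P0"
      | p i j where "E \<noteq> {}" "p \<in> ?S" "P0 \<le> p" "quality Q A B E X Y D < quality_layer Q p i j A B E X Y D"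
      | "E \<noteq> {}" "\<And>p. p \<in> ?S \<Longrightarrow> P0 \<le> p"
        "\<And>p i j. p \<in> ?S \<Longrightarrow> quality_layer Q p i j A B E X Y D \<le> quality Q A B E X Y D"
      by (meson not_le)
    thus ?case
    proof cases
      case 1
      thus ?thesis using L(1) by (simp add: quality_def)
    next
      case (2 p)
      then obtain i j where "quality Q A B E X Y D \<le> L * quality_layer Q p i j A B E X Y D"
        using L(2)[OF G, of p] by (auto simp: prime_support_def)
      also have "\<dots> \<le> L * (16 * L ^ card (?S \<inter> {..<P0} - {p}))"
        using L(1) IH[OF 2(2)] by (intro mult_left_mono) simp_all
      also have "\<dots> = 16 * L ^ Suc (card (?S \<inter> {..<P0} - {p}))" by simp
      also have "Suc (card (?S \<inter> {..<P0} - {p})) = card (?S \<inter> {..<P0})"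
        using 2 fin by (intro card.remove[symmetric]) auto
      finally show ?thesis .
    next
      case (3 p i j)
      hence "quality Q A B E X Y D \<le> 16 * L ^ card (?S \<inter> {..<P0} - {p})"
        using IH[of p i j] by linarith
      also have "\<dots> \<le> 16 * L ^ card (?S \<inter> {..<P0})"
        using L(1) fin by (intro mult_left_mono power_increasing card_mono) auto
      finally show ?thesis .
    next
      case 4
      have "\<forall>p\<in>?S. \<exists>k. real (card {e \<in> E. multiplicity p (fst e) \<noteq> k \<and> multiplicity p (snd e) \<noteq> k}) \<le> c p * card E"
      proof
        fix p assume p: "p \<in> ?S"
        hence "prime p" "P1 \<le> p" using 4(2)[OF p] by (simp_all add: prime_support_def P0_def)
        thus "\<exists>k. real (card {e \<in> E. multiplicity p (fst e) \<noteq> k \<and> multiplicity p (snd e) \<noteq> k}) \<le> c p * card E"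
          using P1[OF G 4(1) _ _ 4(3)[OF p]] by simp
      qed
      from bchoice[OF this] obtain k where k: "\<forall>p\<in>?S.
          real (card {e \<in> E. multiplicity p (fst e) \<noteq> k p \<and> multiplicity p (snd e) \<noteq> k p}) \<le> c p * card E"
        by blast
      have "sum c ?S \<le> 1 / 2" using 4(2) fin by (intro P2) (simp_all add: P0_def)
      hence "quality Q A B E X Y D \<le> 16"
        using Q k by (intro quality_le_of_concentrated[OF G, of Q k c]) simp_all
      thus ?thesis using L16 order_trans by blast
    qed
  qed
  show ?thesis
  proof (rule that[of "16 * L ^ P0"])
    show "0 < 16 * L ^ P0" using L(1) by simp
    fix A B E X Y D assume G: "gcd_system A B E X Y D"
    have "card (prime_support A B \<inter> {..<P0}) \<le> card {..<P0}" by (intro card_mono) auto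
    hence "16 * L ^ card (prime_support A B \<inter> {..<P0}) \<le> 16 * L ^ P0"
      using L(1) by (intro mult_left_mono power_increasing) auto
    thus "quality Q A B E X Y D \<le> 16 * L ^ P0" using main[OF G] by linarith
  qed
qed

section \<open>From bounded quality to the lcm estimate\<close>

lemma card_product_le_of_quality_le:
  assumes G: "gcd_system A B E X Y D" and C: "0 \<le> C" and Q: "1 \<le> Q"
    and le: "quality Q A B E X Y D \<le> C"
    and \<delta>: "0 < \<delta>" "\<delta> * real (card A) * real (card B) \<le> real (card E)"
  shows "real (card A) * real (card B) \<le> C * \<delta> powr (- Q) * (X * Y / D\<^sup>2)"
proof (cases "card A * card B = 0")
  case True
  thus ?thesis using C gcd_systemD(5-7)[OF G] by auto
next
  case False
  note d = gcd_systemD[OF G]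
  define P where "P = real (card A) * real (card B)"
  have P: "0 < P" using False by (simp add: P_def)
  \<comment> \<open>The quality increases with |E|, so |E| may be replaced by its lower bound
    \<delta> P.\<close>
  have "\<delta> powr Q * P = (\<delta> * P) powr Q * P powr (1 - Q)"
    using \<delta> P by (simp add: powr_mult powr_diff)
  also have "\<dots> \<le> real (card E) powr Q * P powr (1 - Q)"
    using \<delta> P Q by (intro mult_right_mono powr_mono2) (auto simp: P_def mult_ac)
  finally have "\<delta> powr Q * P * (D\<^sup>2 / (X * Y)) \<le> real (card E) powr Q * P powr (1 - Q) * (D\<^sup>2 / (X * Y))"
    using d by (intro mult_right_mono) auto
  also have "\<dots> \<le> C" using le by (simp add: quality_def P_def)
  finally show ?thesis
    unfolding P_def[symmetric] using \<delta> d by (simp add: powr_minus field_simps)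
qed

theorem corollary1p4:
  fixes \<epsilon> :: real
  assumes "0 < \<epsilon>" and "\<epsilon> < 1"
  shows "\<exists>C::real. C > 0 \<and>
    (\<forall>(X1::real) (X2::real) (L::real) (\<delta>::real) (A1::int set) (A2::int set).
      1 \<le> X1 \<longrightarrow> 1 \<le> X2 \<longrightarrow> 1 \<le> L \<longrightarrow> max X1 X2 \<le> L \<longrightarrow>
      0 < \<delta> \<longrightarrow> \<delta> \<le> 1 \<longrightarrow>
      (\<forall>a\<in>A1. X1 \<le> real_of_int a \<and> real_of_int a \<le> 2 * X1) \<longrightarrow>
      (\<forall>a\<in>A2. X2 \<le> real_of_int a \<and> real_of_int a \<le> 2 * X2) \<longrightarrow>
      \<delta> * real (card A1) * real (card A2)
        \<le> real (card {(a1, a2) \<in> A1 \<times> A2. real_of_int (lcm a1 a2) \<le> L}) \<longrightarrow>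
      real (card A1) * real (card A2) \<le> C * \<delta> powr (- 2 - \<epsilon>) * (L\<^sup>2 / (X1 * X2)))"
proof -
  define Q where "Q = 2 + \<epsilon>"
  have Q: "2 < Q" using assms by (simp add: Q_def)
  obtain C where C: "0 < C" "\<And>A B E X Y D. gcd_system A B E X Y D \<Longrightarrow> quality Q A B E X Y D \<le> C"
    using quality_bounded[OF Q] by blast
  show ?thesis
  \<comment> \<open>The factor 4 is the cost of the upper endpoints: the vertices are bounded by 2
    X1 and 2 X2.\<close>
  proof (intro exI[of _ "4 * C"] conjI allI impI)
    show "0 < 4 * C" using C by simp
    fix X1 X2 L \<delta> :: real and A1 A2 :: "int set"
    assume X: "1 \<le> X1" "1 \<le> X2" and L: "1 \<le> L" and \<delta>: "0 < \<delta>"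
      and A1: "\<forall>a\<in>A1. X1 \<le> real_of_int a \<and> real_of_int a \<le> 2 * X1"
      and A2: "\<forall>a\<in>A2. X2 \<le> real_of_int a \<and> real_of_int a \<le> 2 * X2"
      and many: "\<delta> * real (card A1) * real (card A2)
        \<le> real (card {(a1, a2) \<in> A1 \<times> A2. real_of_int (lcm a1 a2) \<le> L})"
    define E where "E = {(a1, a2) \<in> A1 \<times> A2. real_of_int (lcm a1 a2) \<le> L}"
    \<comment> \<open>Since X1 and X2 are at least 1, all members are positive, so
      \<open>nat\<close> is injective on them and cardinalities survive the passage from integers to
      naturals.\<close>
    have pos: "0 < a" if "a \<in> A1 \<union> A2" for a
      using that A1 A2 X by force
    have inj: "inj_on nat A1" "inj_on nat A2" "inj_on (map_prod nat nat) E"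
      using pos by (force simp: inj_on_def E_def)+
    have fin: "finite A" if "\<forall>a\<in>A. Z \<le> real_of_int a \<and> real_of_int a \<le> 2 * Z" for A Z
    proof (rule finite_subset)
      show "A \<subseteq> {\<lfloor>Z\<rfloor>..\<lceil>2 * Z\<rceil>}" using that by (auto simp: floor_le_iff le_ceiling_iff)
    qed simp
    have G: "gcd_system (nat ` A1) (nat ` A2) (map_prod nat nat ` E) (2 * X1) (2 * X2) (X1 * X2 / L)"
    proof -
      have "X1 * X2 / L \<le> real (gcd (nat a) (nat b))" if ab: "(a, b) \<in> E" for a b
      proof -
        have p: "0 < a" "0 < b" using ab pos by (auto simp: E_def)
        have "X1 * X2 \<le> real_of_int a * real_of_int b"
          using ab A1 A2 X by (intro mult_mono) (auto simp: E_def intro: order_trans[of 0 X1] order_trans[of 0 X2])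
        \<comment> \<open>The product of lcm and gcd is ab, so an upper bound on the lcm becomes a
          lower bound on the gcd.\<close>
        also have "\<dots> = real_of_int (lcm a b * gcd a b)"
          using p by (simp add: lcm_mult_gcd abs_mult flip: of_int_mult)
        also have "\<dots> \<le> L * real_of_int (gcd a b)"
          unfolding of_int_mult using ab by (intro mult_right_mono) (auto simp: E_def)
        also have "real_of_int (gcd a b) = real (gcd (nat a) (nat b))"
          using p by (simp add: gcd_int_def)
        finally show ?thesis using L by (simp add: field_simps)
      qed
      thus ?thesis
        unfolding gcd_system_def using A1 A2 X L pos fin[OF A1] fin[OF A2]
        by (auto simp: E_def)
    qed
    have "real (card (nat ` A1)) * real (card (nat ` A2))
        \<le> C * \<delta> powr (- Q) * ((2 * X1) * (2 * X2) / (X1 * X2 / L)\<^sup>2)"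
      using C(1) C(2)[OF G] Q \<delta> many inj unfolding E_def[symmetric]
      by (intro card_product_le_of_quality_le[OF G]) (auto simp: card_image)
    also have "(2 * X1) * (2 * X2) / (X1 * X2 / L)\<^sup>2 = 4 * (L\<^sup>2 / (X1 * X2))"
      using X L by (simp add: power2_eq_square field_simps)
    finally show "real (card A1) * real (card A2) \<le> 4 * C * \<delta> powr (- 2 - \<epsilon>) * (L\<^sup>2 / (X1 * X2))"
      using inj by (simp add: card_image Q_def mult_ac)
  qed
qed

end
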